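(* Let $p$ be a prime, $n=p^2$, and let $\Gamma=\Gamma(D_{2n})$ be the intersection graph of $D_{2n}$. Then the first Zagreb index of $\Gamma$ is $M_1(\Gamma)=4p^3+7p^2+5p+2$.
   Context: $D_{2n}=\langle r,s : r^n=s^2=1,\ srs=r^{-1}\rangle$ is the dihedral group of order $2n$. The intersection graph $\Gamma(G)$ of a finite group $G$ has as vertices the proper non-trivial subgroups of $G$, two distinct vertices being adjacent iff their intersection is non-trivial. The first Zagreb index is $M_1(\Gamma)=\sum_{v\in V(\Gamma)}\deg(v)^2$. *)

theory Defs
  imports
    "HOL-Algebra.Group"
    "HOL-Computational_Algebra.Primes"
    "Graph_Theory.Pair_Digraph"
begin

section \<open>Groups given by generators and relations\<close>

text \<open>
  Group words over a type of generators are lists of letters; the letter \<open>(x, False)\<close> stands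
  for \<open>x\<close> and \<open>(x, True)\<close> for its formal inverse. A relation \<open>u = v\<close> is the pair \<open>(u, v)\<close>.
  The presented group is the set of all words modulo the least congruence that contains the
  relations and the free cancellations; this is the free group on the generators modulo the
  normal closure of the relators.
\<close>

type_synonym 'x word = "('x \<times> bool) list"

inductive_set word_cong :: "('x word \<times> 'x word) set \<Rightarrow> ('x word \<times> 'x word) set"
  for E :: "('x word \<times> 'x word) set" where
  relation: "(u, v) \<in> E \<Longrightarrow> (u, v) \<in> word_cong E"
| cancel: "([(x, b), (x, \<not> b)], []) \<in> word_cong E"
| refl: "(u, u) \<in> word_cong E"
| sym: "(u, v) \<in> word_cong E \<Longrightarrow> (v, u) \<in> word_cong E"
| trans: "(u, v) \<in> word_cong E \<Longrightarrow> (v, w) \<in> word_cong E \<Longrightarrow> (u, w) \<in> word_cong E"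
| append: "(u, v) \<in> word_cong E \<Longrightarrow> (u', v') \<in> word_cong E
    \<Longrightarrow> (u @ u', v @ v') \<in> word_cong E"

definition presented_group :: "('x word \<times> 'x word) set \<Rightarrow> 'x word set monoid" where
  "presented_group E =
    \<lparr> carrier = UNIV // word_cong E,
      monoid.mult = (\<lambda>A B. \<Union>u\<in>A. \<Union>v\<in>B. word_cong E `` {u @ v}),
      one = word_cong E `` {[]} \<rparr>"

lemma equiv_word_cong: "equiv UNIV (word_cong E)"
proof (rule equivI)
  show "refl_on UNIV (word_cong E)"
    by (simp add: refl_on_def word_cong.refl)
  show "sym (word_cong E)"
    by (rule symI) (rule word_cong.sym)
  show "trans (word_cong E)"
    by (rule transI) (rule word_cong.trans)
qed simp

lemma word_cong_class_eq_iff: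
  "word_cong E `` {u} = word_cong E `` {v} \<longleftrightarrow> (u, v) \<in> word_cong E"
  using eq_equiv_class_iff[OF equiv_word_cong] by blast

lemma carrier_presented_group:
  "carrier (presented_group E) = range (\<lambda>u. word_cong E `` {u})"
  by (auto simp: presented_group_def quotient_def)

lemma one_presented_group: "\<one>\<^bsub>presented_group E\<^esub> = word_cong E `` {[]}"
  by (simp add: presented_group_def)

lemma mult_presented_group:
  "word_cong E `` {u} \<otimes>\<^bsub>presented_group E\<^esub> word_cong E `` {v} = word_cong E `` {u @ v}"
proof -
  have "word_cong E `` {u' @ v'} = word_cong E `` {u @ v}"
    if "u' \<in> word_cong E `` {u}" "v' \<in> word_cong E `` {v}" for u' v'
    using that word_cong.append[THEN word_cong.sym] by (simp add: word_cong_class_eq_iff)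
  moreover have "u \<in> word_cong E `` {u}" "v \<in> word_cong E `` {v}"
    by (auto intro: word_cong.refl)
  ultimately show ?thesis
    unfolding presented_group_def monoid.simps partial_object.simps by blast
qed

lemma word_cong_inverse:
  "(rev (map (\<lambda>(x, b). (x, \<not> b)) u) @ u, []) \<in> word_cong E"
proof (induction u)
  case Nil
  show ?case by (simp add: word_cong.refl)
next
  case (Cons a u)
  obtain x b where a: "a = (x, b)" by (cases a)
  let ?i = "rev (map (\<lambda>(x, b). (x, \<not> b)) u)"
  have "([(x, \<not> b), (x, b)], []) \<in> word_cong E"
    using word_cong.cancel[of x "\<not> b" E] by simp
  from word_cong.append[OF word_cong.refl[of ?i] word_cong.append[OF this word_cong.refl[of u]]]
  have "(?i @ [(x, \<not> b), (x, b)] @ u, ?i @ u) \<in> word_cong E" by simp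
  from word_cong.trans[OF this Cons.IH] show ?case by (simp add: a)
qed

lemma group_presented_group: "group (presented_group E)"
proof (rule groupI)
  show "\<exists>y\<in>carrier (presented_group E). y \<otimes>\<^bsub>presented_group E\<^esub> x = \<one>\<^bsub>presented_group E\<^esub>"
    if "x \<in> carrier (presented_group E)" for x
  proof -
    from that obtain u where u: "x = word_cong E `` {u}"
      unfolding carrier_presented_group by blast
    let ?y = "word_cong E `` {rev (map (\<lambda>(x, b). (x, \<not> b)) u)}"
    have "?y \<otimes>\<^bsub>presented_group E\<^esub> x = \<one>\<^bsub>presented_group E\<^esub>"
      unfolding u mult_presented_group one_presented_group word_cong_class_eq_iff
      by (rule word_cong_inverse)
    then show ?thesis
      unfolding carrier_presented_group by blast
  qed
qed (auto simp: carrier_presented_group mult_presented_group one_presented_group)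


section \<open>The dihedral group of order $2n$\<close>

datatype dihedral_gen = Rot | Refl  \<comment> \<open>\<open>r\<close> and \<open>s\<close>\<close>

text \<open>The parameter \<open>n\<close> is half the order of the group.\<close>

definition dihedral_group :: "nat \<Rightarrow> dihedral_gen word set monoid" where
  "dihedral_group n = presented_group
    {(replicate n (Rot, False), []),
     ([(Refl, False), (Refl, False)], []),
     ([(Refl, False), (Rot, False), (Refl, False)], [(Rot, True)])}"


section \<open>Intersection graphs and the first Zagreb index\<close>

text \<open>
  As in the library, an undirected simple graph is a symmetric loop-free digraph: an edge is a pair
  of opposite arcs, so the degree of a vertex is its out-degree.
\<close>

definition intersection_graph :: "('a, 'b) monoid_scheme \<Rightarrow> 'a set pair_pre_digraph" where
  "intersection_graph G =
    (let V = {H. subgroup H G \<and> H \<noteq> carrier G \<and> H \<noteq> {\<one>\<^bsub>G\<^esub>}} in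
     \<lparr> pverts = V,
       parcs = {(H, K). H \<in> V \<and> K \<in> V \<and> H \<noteq> K \<and> H \<inter> K \<noteq> {\<one>\<^bsub>G\<^esub>}} \<rparr>)"

definition first_zagreb_index :: "('a, 'b) pre_digraph \<Rightarrow> nat" where
  "first_zagreb_index \<Gamma> = (\<Sum>v\<in>verts \<Gamma>. (out_degree \<Gamma> v)\<^sup>2)"

lemma pair_graph_intersection_graph:
  assumes "finite (carrier G)"
  shows "pair_graph (intersection_graph G)"
proof -
  let ?V = "pverts (intersection_graph G)"
  have "?V \<subseteq> Pow (carrier G)"
    by (auto simp: intersection_graph_def dest: subgroup.subset)
  then have fin: "finite ?V"
    using assms by (simp add: finite_subset)
  have "parcs (intersection_graph G) \<subseteq> ?V \<times> ?V"
    by (auto simp: intersection_graph_def)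
  then have "finite (parcs (intersection_graph G))"
    using fin by (simp add: finite_subset)
  moreover have "symmetric (with_proj (intersection_graph G))"
    unfolding symmetric_def with_proj_simps
    by (rule symI) (auto simp: intersection_graph_def)
  moreover have "H \<in> ?V \<and> K \<in> ?V \<and> H \<noteq> K"
    if "(H, K) \<in> parcs (intersection_graph G)" for H K
    using that unfolding intersection_graph_def Let_def by simp
  moreover from this have "fst e \<in> ?V \<and> snd e \<in> ?V \<and> fst e \<noteq> snd e"
    if "e \<in> parcs (intersection_graph G)" for e
    using that by (cases e) simp
  ultimately show ?thesis
    using fin
    unfolding pair_graph_def pair_digraph_def pair_pseudo_graph_def pair_fin_digraph_def
      pair_fin_digraph_axioms_def pair_loopfree_digraph_def pair_loopfree_digraph_axioms_def
      pair_sym_digraph_def pair_sym_digraph_axioms_def pair_wf_digraph_def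
    by blast
qed

end

theory Submission
  imports Defs
begin

text \<open>
  The vertices are $\langle r\rangle$, $\langle r^p\rangle$, the $p$ dihedral subgroups
  $\langle r^p, r^j s\rangle$ and the $p^2$ subgroups $\langle r^j s\rangle$ of order 2. The first
  $p + 2$ of them all contain $r^p$ and form a clique; each $\langle r^j s\rangle$ hangs as a leaf on
  the unique dihedral vertex containing it, $p$ leaves on each. So the degrees are $p + 1$ (twice),
  $2p + 1$ ($p$ times) and $1$ ($p^2$ times).
\<close>

section \<open>The elements of the dihedral group\<close>

text \<open>
  \<open>R i\<close> stands for $r^i$ and \<open>S i\<close> for $r^i s$. The indices are arbitrary integers, so that the
  multiplication table needs no reduction modulo \<open>n\<close>.
\<close>

locale dihedral = group G for G (structure) +
  fixes n :: int and R S :: "int \<Rightarrow> 'a"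
  assumes n_pos: "n > 0"
    and carrier_eq: "carrier G = range R \<union> range S"
    and R_mult_R: "R i \<otimes> R j = R (i + j)"
    and R_mult_S: "R i \<otimes> S j = S (i + j)"
    and S_mult_R: "S i \<otimes> R j = S (i - j)"
    and S_mult_S: "S i \<otimes> S j = R (i - j)"
    and R_eq_iff: "R i = R j \<longleftrightarrow> n dvd i - j"
    and S_eq_iff: "S i = S j \<longleftrightarrow> n dvd i - j"
    and R_neq_S: "R i \<noteq> S j"

section \<open>The semidirect product of the integers by {1, -1}\<close>

text \<open>Together with \<open>orientation\<close> this is the image of a word in the semidirect
  product of the integers by {1, -1}, where r goes to (1, 1) and s to (0, -1). The inverse mark on
  \<open>Refl\<close> is ignored because (0, -1) is its own inverse.\<close>

fun rotation_part :: "dihedral_gen word \<Rightarrow> int" where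
  "rotation_part [] = 0"
| "rotation_part ((Rot, b) # w) = rotation_part w + (if b then - 1 else 1)"
| "rotation_part ((Refl, b) # w) = - rotation_part w"

fun orientation :: "dihedral_gen word \<Rightarrow> int" where
  "orientation [] = 1"
| "orientation ((Rot, b) # w) = orientation w"
| "orientation ((Refl, b) # w) = - orientation w"

lemma orientation_append: "orientation (u @ v) = orientation u * orientation v"
  by (induction u rule: orientation.induct) auto

text \<open>This is the composition law of the semidirect product: the sign of the first factor acts
  on the translation of the second.\<close>

lemma rotation_part_append:
  "rotation_part (u @ v) = rotation_part u + orientation u * rotation_part v"
  by (induction u rule: rotation_part.induct) auto

lemma rotation_part_replicate: "rotation_part (replicate k (Rot, False)) = int k"
  by (induction k) auto

lemma orientation_replicate: "orientation (replicate k (Rot, b)) = 1"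
  by (induction k) auto

abbreviation dihedral_relations :: "nat \<Rightarrow> (dihedral_gen word \<times> dihedral_gen word) set" where
  "dihedral_relations n \<equiv>
    {(replicate n (Rot, False), []),
     ([(Refl, False), (Refl, False)], []),
     ([(Refl, False), (Rot, False), (Refl, False)], [(Rot, True)])}"

text \<open>
  Words evaluate in $\mathbb{Z}/n \rtimes \{1, -1\}$, which shows that the presented group does not
  collapse.
\<close>

lemma word_cong_dihedral_invariant:
  assumes "(u, v) \<in> word_cong (dihedral_relations n)"
  shows "orientation u = orientation v \<and> int n dvd rotation_part u - rotation_part v"
  using assms
proof (induction rule: word_cong.induct)
  case (relation u v)
  then show ?case by (auto simp: rotation_part_replicate orientation_replicate)
next
  case (cancel x b)
  show ?case by (cases x) auto
next
  case (refl u)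
  show ?case by simp
next
  case (sym u v)
  then show ?case by (simp add: dvd_diff_commute)
next
  case (trans u v w)
  then have "int n dvd (rotation_part u - rotation_part v) + (rotation_part v - rotation_part w)"
    by (blast intro: dvd_add)
  then show ?case using trans by simp
next
  case (append u v u' v')
  then have "int n dvd (rotation_part u - rotation_part v)
      + orientation u * (rotation_part u' - rotation_part v')"
    by (blast intro: dvd_add dvd_mult)
  then show ?case
    using append by (simp add: rotation_part_append orientation_append algebra_simps)
qed

text \<open>Moving s to the right past powers of r brings every word to the form r^i or r^i s. That
  these forms are distinct, up to i modulo \<open>n\<close>, follows from the invariance of
  \<open>rotation_part\<close> and \<open>orientation\<close>.\<close>

lemma dihedral_dihedral_group:
  assumes "n > 0"
  shows "\<exists>R S. dihedral (dihedral_group n) (int n) R S"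
proof -
  define E where "E = dihedral_relations n"
  define G where "G = dihedral_group n"
  have G: "G = presented_group E"
    by (simp add: G_def E_def dihedral_group_def)
  interpret group G
    unfolding G by (rule group_presented_group)
  define cls where "cls u = word_cong E `` {u}" for u
  have carrier: "carrier G = range cls"
    by (auto simp: G carrier_presented_group cls_def)
  then have cls_closed [simp]: "cls u \<in> carrier G" for u by simp
  have one: "\<one>\<^bsub>G\<^esub> = cls []"
    by (simp add: G one_presented_group cls_def)
  have mult: "cls u \<otimes>\<^bsub>G\<^esub> cls v = cls (u @ v)" for u v
    by (simp add: G mult_presented_group cls_def)
  have cls_eq: "cls u = cls v \<longleftrightarrow> (u, v) \<in> word_cong E" for u v
    by (simp add: word_cong_class_eq_iff cls_def)
  define r s where "r = cls [(Rot, False)]" and "s = cls [(Refl, False)]"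
  have [simp]: "r \<in> carrier G" "s \<in> carrier G" by (simp_all add: r_def s_def)
  have rep: "r [^]\<^bsub>G\<^esub> k = cls (replicate k (Rot, False))" for k :: nat
  proof (induction k)
    case 0 show ?case by (simp add: one)
  next
    case (Suc k) then show ?case by (simp add: r_def mult replicate_append_same)
  qed
  have rn: "r [^]\<^bsub>G\<^esub> n = \<one>\<^bsub>G\<^esub>"
    unfolding rep one cls_eq E_def by (rule word_cong.relation) simp
  have ss: "s \<otimes>\<^bsub>G\<^esub> s = \<one>\<^bsub>G\<^esub>"
    unfolding s_def mult one cls_eq E_def by (rule word_cong.relation) simp
  have inv_cls: "inv\<^bsub>G\<^esub> (cls [(x, b)]) = cls [(x, \<not> b)]" for x b
  proof (rule inv_equality)
    have "([(x, \<not> b), (x, b)], []) \<in> word_cong E"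
      using word_cong.cancel[of x "\<not> b"] by simp
    then show "cls [(x, \<not> b)] \<otimes>\<^bsub>G\<^esub> cls [(x, b)] = \<one>\<^bsub>G\<^esub>"
      by (simp add: mult one cls_eq)
  qed simp_all
  have inv_s: "inv\<^bsub>G\<^esub> s = s"
    by (rule inv_equality) (simp_all add: ss)
  have srs: "s \<otimes>\<^bsub>G\<^esub> r \<otimes>\<^bsub>G\<^esub> s = inv\<^bsub>G\<^esub> r"
  proof -
    have "([(Refl, False), (Rot, False), (Refl, False)], [(Rot, True)]) \<in> word_cong E"
      unfolding E_def by (rule word_cong.relation) simp
    then show ?thesis by (simp add: r_def s_def mult inv_cls cls_eq)
  qed
  have sr: "s \<otimes>\<^bsub>G\<^esub> r = inv\<^bsub>G\<^esub> r \<otimes>\<^bsub>G\<^esub> s"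
    unfolding srs[symmetric] by (simp add: m_assoc ss)
  have sr': "s \<otimes>\<^bsub>G\<^esub> inv\<^bsub>G\<^esub> r = r \<otimes>\<^bsub>G\<^esub> s"
  proof -
    have "s \<otimes>\<^bsub>G\<^esub> inv\<^bsub>G\<^esub> r = s \<otimes>\<^bsub>G\<^esub> s \<otimes>\<^bsub>G\<^esub> r \<otimes>\<^bsub>G\<^esub> s"
      unfolding srs[symmetric] by (simp add: m_assoc)
    then show ?thesis by (simp add: ss)
  qed
  define R where "R i = r [^]\<^bsub>G\<^esub> i" for i :: int
  define S where "S i = R i \<otimes>\<^bsub>G\<^esub> s" for i
  have R_closed [simp]: "R i \<in> carrier G" for i by (simp add: R_def)
  have RR: "R i \<otimes>\<^bsub>G\<^esub> R j = R (i + j)" for i j by (simp add: R_def int_pow_mult)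
  have R0: "R 0 = \<one>\<^bsub>G\<^esub>" and R1: "R 1 = r" and Rm1: "R (- 1) = inv\<^bsub>G\<^esub> r"
    by (simp_all add: R_def int_pow_neg)
  \<comment> \<open>The induction runs in both directions over the integers: \<open>sr\<close> moves
    s past r, and \<open>sr'\<close> moves it past the inverse of r.\<close>
  have sR: "s \<otimes>\<^bsub>G\<^esub> R i = R (- i) \<otimes>\<^bsub>G\<^esub> s" for i
  proof (induction i rule: int_induct[where k = 0])
    case base show ?case by (simp add: R0)
  next
    case (step1 i)
    have "s \<otimes>\<^bsub>G\<^esub> R (i + 1) = s \<otimes>\<^bsub>G\<^esub> R i \<otimes>\<^bsub>G\<^esub> r"
      by (simp add: RR[symmetric] R1 m_assoc)
    also have "\<dots> = R (- i) \<otimes>\<^bsub>G\<^esub> R (- 1) \<otimes>\<^bsub>G\<^esub> s"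
      using step1 by (simp add: m_assoc sr Rm1)
    finally show ?case by (simp add: RR)
  next
    case (step2 i)
    have "s \<otimes>\<^bsub>G\<^esub> R (i - 1) = s \<otimes>\<^bsub>G\<^esub> R i \<otimes>\<^bsub>G\<^esub> inv\<^bsub>G\<^esub> r"
      by (simp add: RR[of i "- 1", simplified, symmetric] Rm1 m_assoc)
    also have "\<dots> = R (- i) \<otimes>\<^bsub>G\<^esub> R 1 \<otimes>\<^bsub>G\<^esub> s"
      using step2 by (simp add: m_assoc sr' R1)
    finally show ?case by (simp add: RR)
  qed
  have RS: "R i \<otimes>\<^bsub>G\<^esub> S j = S (i + j)" for i j
    by (simp add: S_def RR m_assoc[symmetric])
  have SR: "S i \<otimes>\<^bsub>G\<^esub> R j = S (i - j)" for i j
    by (simp add: S_def m_assoc sR) (simp add: RR m_assoc[symmetric])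
  have SS: "S i \<otimes>\<^bsub>G\<^esub> S j = R (i - j)" for i j
  proof -
    have "S i \<otimes>\<^bsub>G\<^esub> S j = S i \<otimes>\<^bsub>G\<^esub> R j \<otimes>\<^bsub>G\<^esub> s"
      by (simp add: S_def m_assoc)
    then show ?thesis by (simp add: SR) (simp add: S_def m_assoc ss)
  qed
  have carrier_eq: "carrier G = range R \<union> range S"
  proof
    have "cls w \<in> range R \<union> range S" for w
    proof (induction w)
      case Nil
      have "cls [] = R 0" by (simp add: R0 one)
      then show ?case by simp
    next
      case (Cons a w)
      obtain x b where a: "a = (x, b)" by (cases a)
      have eq: "cls (a # w) = cls [a] \<otimes>\<^bsub>G\<^esub> cls w" by (simp add: mult)
      \<comment> \<open>Both letters of s have the value \<open>S 0\<close>, since s is its own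
        inverse.\<close>
      have "cls [a] \<in> {R 1, R (- 1), S 0}"
      proof (cases x; cases b)
      qed (use inv_cls[of x False] inv_s in
          \<open>auto simp: a R1 Rm1 S_def R0 r_def[symmetric] s_def[symmetric]\<close>)
      with Cons show ?case unfolding eq by (auto simp: RR RS SR SS)
    qed
    then show "carrier G \<subseteq> range R \<union> range S" unfolding carrier by blast
  qed (auto simp: S_def)
  \<comment> \<open>A representing word with exactly known invariants turns an equation between
    group elements into a statement about integers.\<close>
  have R_word: "\<exists>w. R i = cls w \<and> rotation_part w = i \<and> orientation w = 1" for i
  proof (induction i rule: int_induct[where k = 0])
    case base show ?case by (intro exI[of _ "[]"]) (simp add: R0 one)
  next
    case (step1 i)
    then obtain w where "R i = cls w" "rotation_part w = i" "orientation w = 1" by blast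
    then show ?case
      by (intro exI[of _ "(Rot, False) # w"])
        (use RR[of 1 i] mult[of "[(Rot, False)]" w] in \<open>simp add: R1 r_def add.commute\<close>)
  next
    case (step2 i)
    then obtain w where "R i = cls w" "rotation_part w = i" "orientation w = 1" by blast
    then show ?case
      by (intro exI[of _ "(Rot, True) # w"])
        (use RR[of "- 1" i] mult[of "[(Rot, True)]" w] inv_cls[of Rot False]
          in \<open>simp add: Rm1 r_def\<close>)
  qed
  have invariant: "orientation u = orientation v \<and> int n dvd rotation_part u - rotation_part v"
    if "cls u = cls v" for u v
    using that word_cong_dihedral_invariant unfolding cls_eq E_def by blast
  have R_dvd: "int n dvd i - j" if "R i = R j" for i j
    using R_word[of i] R_word[of j] invariant that by metis
  have R_period: "R i = R j" if "int n dvd i - j" for i j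
  proof -
    from that obtain k where "i = int n * k + j"
      by (metis dvdE diff_add_cancel)
    moreover have "R (int n * k) = \<one>\<^bsub>G\<^esub>"
      using rn by (simp add: R_def int_pow_pow[symmetric] int_pow_int)
    ultimately show ?thesis by (metis RR R_closed l_one)
  qed
  have S_eq: "S i = S j \<longleftrightarrow> R i = R j" for i j
    by (simp add: S_def)
  have R_neq_S: "R i \<noteq> S j" for i j
  proof
    assume eq: "R i = S j"
    obtain u where u: "R i = cls u" "orientation u = 1" using R_word by blast
    obtain v where v: "R j = cls v" "orientation v = 1" using R_word by blast
    \<comment> \<open>The two sides would be represented by words of opposite orientation.\<close>
    have "cls u = cls (v @ [(Refl, False)])"
      using eq u v by (simp add: S_def s_def mult)
    then show False
      using invariant[of u "v @ [(Refl, False)]"] eq u v by (simp add: orientation_append)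
  qed
  have "dihedral G (int n) R S"
  proof unfold_locales
    show "R i = R j \<longleftrightarrow> int n dvd i - j" for i j using R_dvd R_period by blast
    then show "S i = S j \<longleftrightarrow> int n dvd i - j" for i j by (simp add: S_eq)
  qed (simp_all add: assms carrier_eq RR RS SR SS R_neq_S)
  then show ?thesis unfolding G_def by blast
qed


section \<open>Subgroups\<close>

text \<open>The least positive element of \<open>A\<close> divides all others, since a non-zero
  remainder would be a smaller positive element. It is applied to the exponents of the rotations in
  a subgroup.\<close>

lemma int_subgroup_generator:
  fixes A :: "int set"
  assumes "m \<in> A" "m > 0" and diff: "\<And>i j. i \<in> A \<Longrightarrow> j \<in> A \<Longrightarrow> i - j \<in> A"
  obtains d where "d > 0" "A = {i. d dvd i}"
proof -
  define k where "k = (LEAST k. k > 0 \<and> int k \<in> A)"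
  have ex: "nat m > 0 \<and> int (nat m) \<in> A" using assms by simp
  have k: "k > 0" "int k \<in> A"
    using LeastI[of "\<lambda>k. k > 0 \<and> int k \<in> A", OF ex] by (auto simp: k_def)
  have k_le: "k \<le> l" if "l > 0" "int l \<in> A" for l
    unfolding k_def using that by (intro Least_le) simp
  have zero: "0 \<in> A" using diff[OF k(2) k(2)] by simp
  have neg: "- i \<in> A" if "i \<in> A" for i using diff[OF zero that] by simp
  have add: "i + j \<in> A" if "i \<in> A" "j \<in> A" for i j using diff[OF that(1) neg[OF that(2)]] by simp
  have multiple: "int k * q \<in> A" for q
  proof (induction q rule: int_induct[where k = 0])
    case base show ?case using zero by simp
  next
    case (step1 i) then show ?case using add k by (simp add: distrib_left)
  next
    case (step2 i) then show ?case using diff k by (simp add: right_diff_distrib)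
  qed
  have "int k dvd i" if "i \<in> A" for i
  proof (rule ccontr)
    assume "\<not> int k dvd i"
    then have "i mod int k > 0"
      using k by (metis dvd_eq_mod_eq_0 of_nat_0_less_iff order_le_less pos_mod_sign)
    moreover have "i mod int k \<in> A"
      using diff[OF that multiple[of "i div int k"]] by (simp add: minus_mult_div_eq_mod)
    ultimately have "int k \<le> i mod int k"
      using k_le[of "nat (i mod int k)"] by simp
    moreover have "i mod int k < int k" using k by simp
    ultimately show False by simp
  qed
  then have "A = {i. int k dvd i}" using multiple by (auto elim!: dvdE)
  with k show ?thesis using that[of "int k"] by simp
qed

context dihedral
begin

section \<open>The subgroups <r^d> and <r^d, r^j s>\<close>

definition rotations :: "int \<Rightarrow> 'a set" where
  "rotations d = R ` {i. d dvd i}"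

text \<open>This is <r^d, r^j s>. The extreme cases are \<open>d = 1\<close>, the whole group, and
  \<open>d = n\<close>, a subgroup of order 2 generated by one reflection.\<close>

definition dihedral_sub :: "int \<Rightarrow> int \<Rightarrow> 'a set" where
  "dihedral_sub d j = rotations d \<union> S ` {i. d dvd i - j}"

lemma R_closed [simp]: "R i \<in> carrier G" and S_closed [simp]: "S i \<in> carrier G"
  by (auto simp: carrier_eq)

lemma one_eq: "\<one> = R 0"
  using R_mult_R[of 0 0] l_cancel_one[of "R 0" "R 0"] by simp

lemma R_eq_one_iff: "R i = \<one> \<longleftrightarrow> n dvd i"
  by (simp add: one_eq R_eq_iff)

lemma S_neq_one: "S i \<noteq> \<one>"
  using R_neq_S by (metis one_eq)

lemma inv_R: "inv (R i) = R (- i)"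
  by (rule inv_equality) (simp_all add: R_mult_R one_eq)

lemma inv_S: "inv (S i) = S i"
  by (rule inv_equality) (simp_all add: S_mult_S one_eq)

text \<open>The index of a rotation is determined only modulo \<open>n\<close>; since
  \<open>d\<close> divides \<open>n\<close>, divisibility by \<open>d\<close> does not depend on the
  chosen index.\<close>

lemma R_mem_rotations: "d dvd n \<Longrightarrow> R i \<in> rotations d \<longleftrightarrow> d dvd i"
  unfolding rotations_def
  by (auto simp: R_eq_iff) (metis dvd_trans diff_add_cancel dvd_add)

lemma S_notin_rotations: "S i \<notin> rotations d"
  using R_neq_S by (metis imageE rotations_def)

lemma R_mem_dihedral_sub: "d dvd n \<Longrightarrow> R i \<in> dihedral_sub d j \<longleftrightarrow> d dvd i"
  using R_neq_S by (auto simp: dihedral_sub_def R_mem_rotations)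

lemma S_mem_dihedral_sub: "d dvd n \<Longrightarrow> S i \<in> dihedral_sub d j \<longleftrightarrow> d dvd i - j"
proof
  assume "d dvd n" "S i \<in> dihedral_sub d j"
  then obtain k where "n dvd i - k" "d dvd k - j"
    by (auto simp: dihedral_sub_def S_notin_rotations S_eq_iff)
  with \<open>d dvd n\<close> have "d dvd (i - k) + (k - j)"
    by (blast intro: dvd_add dvd_trans)
  then show "d dvd i - j" by simp
qed (auto simp: dihedral_sub_def)

lemmas mem_simps =
  R_mem_rotations S_notin_rotations R_mem_dihedral_sub S_mem_dihedral_sub

lemma set_eqI_carrier:
  assumes "A \<subseteq> carrier G" "B \<subseteq> carrier G"
    and "\<And>i. R i \<in> A \<longleftrightarrow> R i \<in> B" "\<And>i. S i \<in> A \<longleftrightarrow> S i \<in> B"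
  shows "A = B"
  using assms unfolding carrier_eq by blast

lemma rotations_subset: "rotations d \<subseteq> carrier G"
  and dihedral_sub_subset: "dihedral_sub d j \<subseteq> carrier G"
  by (auto simp: rotations_def dihedral_sub_def)

lemma subgroup_rotations: "subgroup (rotations d) G"
proof (rule subgroupI)
  show "rotations d \<noteq> {}" by (auto simp: rotations_def)
qed (auto simp: rotations_def inv_R R_mult_R)

lemma subgroup_dihedral_sub: "subgroup (dihedral_sub d j) G"
proof (rule subgroupI)
  fix a b assume a: "a \<in> dihedral_sub d j" and b: "b \<in> dihedral_sub d j"
  have ex: "(\<exists>i. a = R i \<and> d dvd i) \<or> (\<exists>i. a = S i \<and> d dvd i - j)"
    if "a \<in> dihedral_sub d j" for a
    using that by (auto simp: dihedral_sub_def rotations_def)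
  have in_R: "R i \<in> dihedral_sub d j" if "d dvd i" for i
    using that by (auto simp: dihedral_sub_def rotations_def)
  have in_S: "S i \<in> dihedral_sub d j" if "d dvd i - j" for i
    using that by (auto simp: dihedral_sub_def)
  have d1: "d dvd i + k - j" if "d dvd i" "d dvd k - j" for i k
    using dvd_add[OF that] by (simp add: algebra_simps)
  have d2: "d dvd i - k - j" if "d dvd k" "d dvd i - j" for i k
    using dvd_diff[OF that(2,1)] by (simp add: algebra_simps)
  have d3: "d dvd i - k" if "d dvd i - j" "d dvd k - j" for i k
    using dvd_diff[OF that] by simp
  show "inv a \<in> dihedral_sub d j"
    using ex[OF a] by (auto simp: inv_R inv_S intro!: in_R in_S)
  show "a \<otimes> b \<in> dihedral_sub d j"
    using ex[OF a] ex[OF b]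
    by (elim disjE exE conjE)
      (simp_all add: R_mult_R R_mult_S S_mult_R S_mult_S in_R in_S d1 d2 d3)
qed (use dihedral_sub_subset in \<open>auto simp: dihedral_sub_def rotations_def\<close>)

section \<open>Classification of the subgroups\<close>

text \<open>The exponents of the rotations in \<open>H\<close> form a subgroup of the integers
  containing \<open>n\<close>, hence consist of the multiples of some divisor \<open>d\<close> of
  \<open>n\<close>. A single reflection in \<open>H\<close> then determines all its
  reflections.\<close>

lemma subgroup_cases:
  assumes H: "subgroup H G"
  obtains d where "d > 0" "d dvd n" "H = rotations d"
  | d j where "d > 0" "d dvd n" "H = dihedral_sub d j"
proof -
  note cl = subgroup.m_closed[OF H] subgroup.m_inv_closed[OF H]
  define A where "A = {i. R i \<in> H}"
  have "n \<in> A"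
    using subgroup.one_closed[OF H] R_eq_one_iff[of n] by (simp add: A_def)
  moreover have "i - j \<in> A" if "i \<in> A" "j \<in> A" for i j
    using that cl(1)[of "R i" "inv (R j)"] cl(2)[of "R j"] by (simp add: A_def inv_R R_mult_R)
  ultimately obtain d where d: "d > 0" "A = {i. d dvd i}"
    using int_subgroup_generator n_pos by blast
  have dn: "d dvd n" using \<open>n \<in> A\<close> d by simp
  have RH: "R i \<in> H \<longleftrightarrow> d dvd i" for i using d by (auto simp: A_def)
  show ?thesis
  proof (cases "\<exists>j. S j \<in> H")
    case False
    then have "H = rotations d"
      by (intro set_eqI_carrier subgroup.subset[OF H] rotations_subset)
        (simp_all add: RH dn mem_simps)
    with d dn that show ?thesis by blast
  next
    case True
    then obtain j where j: "S j \<in> H" by blast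
    \<comment> \<open>Multiplication by \<open>S j\<close> on the right exchanges \<open>S i\<close>
      and \<open>R (i - j)\<close>, so the reflections in \<open>H\<close> are read off from its
      rotations.\<close>
    have SH: "S i \<in> H \<longleftrightarrow> d dvd i - j" for i
    proof
      assume "S i \<in> H"
      then show "d dvd i - j" using cl(1)[OF _ j, of "S i"] by (simp add: S_mult_S RH)
    next
      assume "d dvd i - j"
      then show "S i \<in> H" using cl(1)[OF _ j, of "R (i - j)"] by (simp add: R_mult_S RH)
    qed
    have "H = dihedral_sub d j"
      by (intro set_eqI_carrier subgroup.subset[OF H] dihedral_sub_subset)
        (simp_all add: RH SH dn mem_simps)
    with d dn that show ?thesis by blast
  qed
qed

section \<open>Coincidences among the dihedral subgroups\<close>

lemma dihedral_sub_eq_iff: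
  assumes "d dvd n"
  shows "dihedral_sub d i = dihedral_sub d j \<longleftrightarrow> d dvd i - j"
proof
  assume "dihedral_sub d i = dihedral_sub d j"
  then show "d dvd i - j"
    using S_mem_dihedral_sub[OF assms, of i i] S_mem_dihedral_sub[OF assms, of i j] by simp
next
  assume ij: "d dvd i - j"
  have "d dvd k - i \<longleftrightarrow> d dvd k - j" for k
    using dvd_add_right_iff[OF ij, of "k - i"] by simp
  then show "dihedral_sub d i = dihedral_sub d j"
    unfolding dihedral_sub_def by simp
qed

text \<open>With \<open>inj_on_dihedral_sub\<close> this lets the range from 0 to
  \<open>d - 1\<close> index the dihedral subgroups for a fixed \<open>d\<close> without
  repetition.\<close>

lemma dihedral_sub_mod:
  assumes "d dvd n"
  shows "dihedral_sub d (j mod d) = dihedral_sub d j"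
  using assms by (simp add: dihedral_sub_eq_iff mod_eq_dvd_iff[symmetric])

lemma inj_on_dihedral_sub:
  assumes "d dvd n"
  shows "inj_on (dihedral_sub d) {0..<d}"
proof (rule inj_onI)
  fix i j assume "i \<in> {0..<d}" "j \<in> {0..<d}" "dihedral_sub d i = dihedral_sub d j"
  then show "i = j"
    using assms by (simp add: dihedral_sub_eq_iff mod_eq_dvd_iff[symmetric])
qed

lemma dihedral_sub_n: "dihedral_sub n j = {\<one>, S j}"
  by (rule set_eqI_carrier[OF dihedral_sub_subset])
    (simp_all add: mem_simps R_eq_one_iff S_neq_one S_eq_iff R_neq_S)

end


section \<open>The intersection graph for the square of a prime\<close>

text \<open>The arcs leaving \<open>H\<close> are the pairs of \<open>H\<close> with its neighbours,
  so the out-degree becomes a plain count of subgroups.\<close>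

lemma first_zagreb_index_intersection_graph:
  fixes G (structure)
  defines "V \<equiv> {H. subgroup H G \<and> H \<noteq> carrier G \<and> H \<noteq> {\<one>}}"
  shows "first_zagreb_index (with_proj (intersection_graph G))
    = (\<Sum>H\<in>V. (card {K \<in> V. K \<noteq> H \<and> H \<inter> K \<noteq> {\<one>}})\<^sup>2)"
proof -
  have pverts: "pverts (intersection_graph G) = V"
    and parcs: "parcs (intersection_graph G)
      = {(H, K). H \<in> V \<and> K \<in> V \<and> H \<noteq> K \<and> H \<inter> K \<noteq> {\<one>}}"
    unfolding intersection_graph_def V_def Let_def by simp_all
  have "out_degree (with_proj (intersection_graph G)) H = card {K \<in> V. K \<noteq> H \<and> H \<inter> K \<noteq> {\<one>}}"
    if "H \<in> V" for H
  proof -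
    have "out_arcs (with_proj (intersection_graph G)) H
        = Pair H ` {K \<in> V. K \<noteq> H \<and> H \<inter> K \<noteq> {\<one>}}"
    proof (rule Set.set_eqI)
      fix e
      show "e \<in> out_arcs (with_proj (intersection_graph G)) H
        \<longleftrightarrow> e \<in> Pair H ` {K \<in> V. K \<noteq> H \<and> H \<inter> K \<noteq> {\<one>}}"
        using that by (cases e) (simp add: out_arcs_def parcs image_iff; blast)
    qed
    then show ?thesis by (simp add: out_degree_def card_image inj_on_def)
  qed
  then show ?thesis
    unfolding first_zagreb_index_def with_proj_simps pverts by (intro sum.cong) simp_all
qed

locale dihedral_prime_square = dihedral +
  fixes p :: int
  assumes prime_p: "Factorial_Ring.prime p" and n_eq: "n = p\<^sup>2"
begin

lemma p_gt_1: "p > 1"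
  using prime_p by (simp add: prime_gt_1_int)

lemma p_dvd_n: "p dvd n"
  by (simp add: n_eq power2_eq_square)

lemma n_not_dvd_p: "\<not> n dvd p"
  using p_gt_1 by (simp add: n_eq power2_eq_square)

lemma divisor_cases:
  assumes "d > 0" "d dvd n"
  shows "d \<in> {1, p, n}"
proof -
  obtain k where "k \<le> 2" "d = p ^ k"
    using divides_primepow[OF prime_p, of d 2] assms by (auto simp: n_eq)
  then show ?thesis by (auto simp: n_eq numeral_2_eq_2 le_Suc_eq)
qed

section \<open>The vertices\<close>

text \<open>These turn out to be the vertices containing r^p, while those in \<open>small\<close>
  avoid it; the element r^p is what separates the two classes.\<close>

definition large :: "'a set set" where
  "large = {rotations 1, rotations p} \<union> dihedral_sub p ` {0..<p}"

definition small :: "'a set set" where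
  "small = dihedral_sub n ` {0..<n}"

lemma R_p_mem_large: "H \<in> large \<Longrightarrow> R p \<in> H"
  by (auto simp: large_def mem_simps p_dvd_n)

lemma R_p_notin_small: "H \<in> small \<Longrightarrow> R p \<notin> H"
  using n_not_dvd_p by (auto simp: small_def mem_simps)

lemma subgroup_large: "H \<in> large \<Longrightarrow> subgroup H G"
  and subgroup_small: "H \<in> small \<Longrightarrow> subgroup H G"
  by (auto simp: large_def small_def subgroup_rotations subgroup_dihedral_sub)

text \<open>The divisor \<open>d\<close> in the classification is 1, \<open>p\<close> or
  \<open>n\<close>. Dropping the trivial group \<open>rotations n\<close> and the whole group
  \<open>dihedral_sub 1 j\<close> leaves exactly the listed subgroups.\<close>

lemma vertices_eq:
  "{H. subgroup H G \<and> H \<noteq> carrier G \<and> H \<noteq> {\<one>}} = large \<union> small" (is "?V = _")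
proof (intro equalityI subsetI)
  fix H assume "H \<in> ?V"
  then have H: "subgroup H G" "H \<noteq> carrier G" "H \<noteq> {\<one>}" by auto
  from H(1) show "H \<in> large \<union> small"
  proof (cases rule: subgroup_cases)
    case (1 d)
    have "d \<noteq> n"
    proof
      assume "d = n"
      then have "H = {\<one>}"
        unfolding 1 by (intro set_eqI_carrier[OF rotations_subset])
          (simp_all add: mem_simps R_eq_one_iff S_neq_one)
      with H show False by simp
    qed
    with divisor_cases 1 show ?thesis by (auto simp: large_def)
  next
    case (2 d j)
    have "d \<noteq> 1"
    proof
      assume "d = 1"
      then have "H = carrier G"
        unfolding 2 by (intro set_eqI_carrier[OF dihedral_sub_subset]) (simp_all add: mem_simps)
      with H show False by simp
    qed
    moreover have "j mod d \<in> {0..<d}" using 2 by simp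
    then have "H \<in> dihedral_sub d ` {0..<d}"
      using 2 dihedral_sub_mod[of d j] by blast
    ultimately show ?thesis
      using divisor_cases[of d] 2 by (auto simp: large_def small_def)
  qed
next
  fix H assume H: "H \<in> large \<union> small"
  have sub: "subgroup H G" using H subgroup_large subgroup_small by blast
  \<comment> \<open>A listed subgroup without reflections misses every \<open>S j\<close>; one with
    a reflection is some \<open>dihedral_sub p j\<close> or \<open>dihedral_sub n j\<close> and
    misses r.\<close>
  have "H \<noteq> carrier G"
  proof (cases "\<exists>j. S j \<in> H")
    case False then show ?thesis using S_closed by blast
  next
    case True
    then have "R 1 \<notin> H"
      using H p_gt_1 n_not_dvd_p
      by (auto simp: large_def small_def mem_simps p_dvd_n dest: dvd_trans[OF p_dvd_n])
    then show ?thesis using R_closed by blast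
  qed
  moreover have "H \<noteq> {\<one>}"
    using H R_p_mem_large[of H] R_eq_one_iff[of p] n_not_dvd_p S_neq_one
    by (auto simp: small_def dihedral_sub_n)
  ultimately show "H \<in> ?V" using sub by simp
qed

lemma finite_large: "finite large" and finite_small: "finite small"
  by (simp_all add: large_def small_def)

lemma large_small_disjoint: "large \<inter> small = {}"
  using R_p_mem_large R_p_notin_small by blast

lemma rotations_1_neq_p: "rotations 1 \<noteq> rotations p"
  using R_mem_rotations[of 1 1] R_mem_rotations[OF p_dvd_n, of 1] p_gt_1 by auto

lemma rotations_notin_dihedral_sub: "rotations d \<notin> dihedral_sub e ` X"
proof
  assume "rotations d \<in> dihedral_sub e ` X"
  then obtain j where "rotations d = dihedral_sub e j" by blast
  moreover have "S j \<in> dihedral_sub e j" by (simp add: dihedral_sub_def)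
  ultimately show False using S_notin_rotations by metis
qed

lemma card_large: "card large = nat p + 2"
  by (simp add: large_def rotations_1_neq_p rotations_notin_dihedral_sub
      card_image inj_on_dihedral_sub p_dvd_n)

section \<open>Adjacency and degrees\<close>

lemma large_inter_large: "H \<in> large \<Longrightarrow> K \<in> large \<Longrightarrow> H \<inter> K \<noteq> {\<one>}"
  using R_p_mem_large R_eq_one_iff n_not_dvd_p by blast

text \<open>The only non-trivial element of \<open>dihedral_sub n j\<close> is \<open>S j\<close>,
  so adjacency to such a vertex is a membership question.\<close>

lemma inter_small:
  assumes "subgroup H G"
  shows "H \<inter> dihedral_sub n j = {\<one>} \<longleftrightarrow> S j \<notin> H"
  using subgroup.one_closed[OF assms] S_neq_one[of j] by (auto simp: dihedral_sub_n)

text \<open>The neighbours are the other \<open>p + 1\<close> members of the clique and the order-2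
  subgroups whose reflection lies in \<open>H\<close>. The last count stays open, since it depends
  on whether \<open>H\<close> contains reflections.\<close>

lemma card_neighbours_large:
  assumes "H \<in> large"
  shows "card {K \<in> large \<union> small. K \<noteq> H \<and> H \<inter> K \<noteq> {\<one>}}
    = nat p + 1 + card {j \<in> {0..<n}. S j \<in> H}"
proof -
  define adj where "adj K \<longleftrightarrow> H \<inter> K \<noteq> {\<one>}" for K
  define B where "B = dihedral_sub n ` {j \<in> {0..<n}. S j \<in> H}"
  have adj_large: "adj K" if "K \<in> large" for K
    using large_inter_large[OF assms that] by (simp add: adj_def)
  have adj_dihedral_sub: "adj (dihedral_sub n j) \<longleftrightarrow> S j \<in> H" for j
    by (simp add: adj_def inter_small subgroup_large assms)
  have B: "K \<in> B \<longleftrightarrow> K \<in> small \<and> adj K" for K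
    unfolding B_def small_def using adj_dihedral_sub by blast
  have "{K \<in> large \<union> small. K \<noteq> H \<and> adj K} = (large - {H}) \<union> B"
    using B adj_large assms large_small_disjoint by blast
  moreover have "(large - {H}) \<inter> B = {}" using B large_small_disjoint by blast
  moreover have "finite B" using B by (intro finite_subset[OF _ finite_small]) blast
  moreover have "card B = card {j \<in> {0..<n}. S j \<in> H}"
    unfolding B_def by (intro card_image inj_on_subset[OF inj_on_dihedral_sub]) auto
  moreover have "card (large - {H}) = nat p + 1"
    using assms by (simp add: card_large finite_large)
  ultimately show ?thesis
    by (simp add: card_Un_disjoint finite_large adj_def)
qed

text \<open>A vertex containing r^j s is \<open>dihedral_sub d j\<close> with \<open>d\<close> equal
  to \<open>p\<close> or \<open>n\<close>. The choice \<open>n\<close> gives \<open>H\<close>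
  itself, so only \<open>dihedral_sub p j\<close> remains.\<close>

lemma card_neighbours_small:
  assumes "H \<in> small"
  shows "card {K \<in> large \<union> small. K \<noteq> H \<and> H \<inter> K \<noteq> {\<one>}} = 1"
proof -
  obtain j where j: "j \<in> {0..<n}" "H = dihedral_sub n j"
    using assms by (auto simp: small_def)
  define adj where "adj K \<longleftrightarrow> H \<inter> K \<noteq> {\<one>}" for K
  have adj: "adj K \<longleftrightarrow> S j \<in> K" if "K \<in> large \<union> small" for K
  proof -
    have "subgroup K G" using that subgroup_large subgroup_small by blast
    then show ?thesis using inter_small[of K j] by (simp add: adj_def j(2) Int_commute)
  qed
  have eq: "dihedral_sub d i = dihedral_sub d j" if "d dvd n" "S j \<in> dihedral_sub d i" for d i
  proof -
    have "d dvd j - i" using that by (simp add: S_mem_dihedral_sub)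
    then show ?thesis using that(1) by (simp add: dihedral_sub_eq_iff dvd_diff_commute[of d i j])
  qed
  have not_adj: "\<not> adj K" if K: "K \<in> small" "K \<noteq> H" for K
  proof -
    obtain i where "K = dihedral_sub n i" using K(1) unfolding small_def by blast
    then show ?thesis using eq[of n i] K adj[of K] j(2) by auto
  qed
  have large_eq: "K = dihedral_sub p j" if K: "K \<in> large" "adj K" for K
  proof -
    have "S j \<in> K" using K adj by blast
    then obtain i where "K = dihedral_sub p i"
      using K(1) S_notin_rotations unfolding large_def by blast
    then show ?thesis using eq[OF p_dvd_n] \<open>S j \<in> K\<close> by blast
  qed
  \<comment> \<open>Here \<open>j\<close> ranges up to \<open>n\<close>, whereas
    \<open>large\<close> is indexed by residues below \<open>p\<close>; hence the reduction modulo
    \<open>p\<close>.\<close>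
  have "dihedral_sub p j \<in> large"
  proof -
    have "j mod p \<in> {0..<p}" using p_gt_1 by simp
    then have "dihedral_sub p (j mod p) \<in> large" unfolding large_def by blast
    then show ?thesis by (simp add: dihedral_sub_mod p_dvd_n)
  qed
  moreover from this have "adj (dihedral_sub p j)" by (simp add: adj S_mem_dihedral_sub p_dvd_n)
  ultimately have "{K \<in> large \<union> small. K \<noteq> H \<and> adj K} = {dihedral_sub p j}"
    using not_adj large_eq assms large_small_disjoint by blast
  then show ?thesis by (simp add: adj_def)
qed

text \<open>The indices below p^2 congruent to \<open>j\<close> modulo \<open>p\<close> are j + p k
  with 0 \<le> k < p.\<close>

lemma card_reflections_dihedral_sub:
  assumes "j \<in> {0..<p}"
  shows "card {i \<in> {0..<n}. S i \<in> dihedral_sub p j} = nat p"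
proof -
  have "{i \<in> {0..<n}. S i \<in> dihedral_sub p j} = (\<lambda>k. j + p * k) ` {0..<p}"
  proof (intro equalityI subsetI)
    fix i assume "i \<in> {i \<in> {0..<n}. S i \<in> dihedral_sub p j}"
    then have i: "0 \<le> i" "i < p * p" "p dvd i - j"
      by (auto simp: mem_simps p_dvd_n n_eq power2_eq_square)
    then obtain k where k: "i = j + p * k"
      by (metis dvdE add.commute diff_add_cancel)
    have "i div p = k" using assms p_gt_1 by (simp add: k)
    moreover have "i div p \<ge> 0" using i p_gt_1 by (simp add: pos_imp_zdiv_nonneg_iff)
    moreover have "p * k < p * p" using i(2) assms unfolding k atLeastLessThan_iff by linarith
    then have "k < p" using p_gt_1 by simp
    ultimately show "i \<in> (\<lambda>k. j + p * k) ` {0..<p}" using k by auto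
  next
    fix i assume "i \<in> (\<lambda>k. j + p * k) ` {0..<p}"
    then obtain k where k: "0 \<le> k" "k < p" "i = j + p * k" by auto
    \<comment> \<open>The bound k \<le> p - 1 gives j + p k < p + p (p - 1) = n.\<close>
    have "p * k \<le> p * (p - 1)" using k p_gt_1 by (intro mult_left_mono) auto
    then have "i < n" using k assms by (simp add: n_eq power2_eq_square algebra_simps)
    then show "i \<in> {i \<in> {0..<n}. S i \<in> dihedral_sub p j}"
      using k assms by (simp add: mem_simps p_dvd_n)
  qed
  moreover have "inj_on (\<lambda>k. j + p * k) {0..<p}" using p_gt_1 by (auto simp: inj_on_def)
  ultimately show ?thesis by (simp add: card_image)
qed

section \<open>Summation of the squared degrees\<close>

lemma first_zagreb_index_eq:
  "first_zagreb_index (with_proj (intersection_graph G))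
    = 4 * nat p ^ 3 + 7 * nat p ^ 2 + 5 * nat p + 2"
proof -
  define deg where "deg H = card {K \<in> large \<union> small. K \<noteq> H \<and> H \<inter> K \<noteq> {\<one>}}" for H
  \<comment> \<open>Rotation subgroups contain no reflection and so carry no leaves.\<close>
  have rot: "deg (rotations d) = nat p + 1" if "rotations d \<in> large" for d
    using card_neighbours_large[OF that] by (simp add: deg_def S_notin_rotations)
  \<comment> \<open>There are p + 1 neighbours in the clique and p leaves.\<close>
  have dih: "deg (dihedral_sub p j) = 2 * nat p + 1" if "j \<in> {0..<p}" for j
    using card_neighbours_large[of "dihedral_sub p j"] card_reflections_dihedral_sub[OF that] that
    by (simp add: deg_def large_def)
  have small: "deg H = 1" if "H \<in> small" for H
    using card_neighbours_small[OF that] by (simp add: deg_def)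
  have "card small = nat p ^ 2"
    using p_gt_1
    by (simp add: small_def card_image inj_on_dihedral_sub) (simp add: n_eq nat_power_eq)
  then have sum_small: "(\<Sum>H\<in>small. (deg H)\<^sup>2) = nat p ^ 2" by (simp add: small)
  have "(\<Sum>H\<in>dihedral_sub p ` {0..<p}. (deg H)\<^sup>2) = nat p * (2 * nat p + 1)\<^sup>2"
    by (simp add: sum.reindex inj_on_dihedral_sub p_dvd_n dih)
  then have sum_large: "(\<Sum>H\<in>large. (deg H)\<^sup>2) = 2 * (nat p + 1)\<^sup>2 + nat p * (2 * nat p + 1)\<^sup>2"
    using rot[of 1] rot[of p]
    by (simp add: large_def rotations_1_neq_p rotations_notin_dihedral_sub)
  have "first_zagreb_index (with_proj (intersection_graph G)) = (\<Sum>H\<in>large \<union> small. (deg H)\<^sup>2)"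
    unfolding first_zagreb_index_intersection_graph vertices_eq deg_def ..
  also have "\<dots> = (\<Sum>H\<in>large. (deg H)\<^sup>2) + (\<Sum>H\<in>small. (deg H)\<^sup>2)"
    by (rule sum.union_disjoint) (simp_all add: finite_large finite_small large_small_disjoint)
  also have "\<dots> = 4 * nat p ^ 3 + 7 * nat p ^ 2 + 5 * nat p + 2"
    unfolding sum_large sum_small by (simp add: power2_eq_square power3_eq_cube algebra_simps)
  finally show ?thesis .
qed

end

theorem theorem3p3:
  fixes p n :: nat
  assumes "Factorial_Ring.prime p" and "n = p ^ 2"
  shows "first_zagreb_index (with_proj (intersection_graph (dihedral_group n)))
    = 4 * p ^ 3 + 7 * p ^ 2 + 5 * p + 2"
proof -
  have "n > 0" using assms by (simp add: prime_gt_0_nat)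
  then obtain R S where "dihedral (dihedral_group n) (int n) R S"
    using dihedral_dihedral_group by blast
  then interpret dihedral "dihedral_group n" "int n" R S .
  interpret dihedral_prime_square "dihedral_group n" "int n" R S "int p"
    using assms by unfold_locales simp_all
  show ?thesis using first_zagreb_index_eq by simp
qed

end
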